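(* Let $q$ be an indeterminate and let $\{C_n(x|q)\}_{n\geq 1}\subset \mathbb{Q}(q)[x]$ be the sequence of polynomials defined by $C_1(x|q)=1$ and, for $n\geq 1$, $$\frac{C_{n+1}(x|q)-C_{n+1}(q^{-1}x-q^{-1}|q)}{1+(q-1)x}=C_n(qx+1|q),\qquad C_{n+1}(-\tfrac1q|q)=0.$$ Then for all $n\geq 0$, $$C_{n+1}(x|q)=\sum_{j=0}^{n}f(n+j,n-j|q^{-1})\, q^{jn+\frac{1}{2}(n-j)(n+j+1)}{x\choose j}_q,$$ and for all $n\geq 1$, $$C_{n}(qx+1|q)=\sum_{j=0}^{n-1}f(n+j,n-1-j|q^{-1})\,q^{jn+\frac{1}{2}n(n+1)-\frac{1}{2}(j+1)(j+2)}{x\choose j}_q.$$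
   Context: For an integer $m\geq 0$, $[m]_q=\frac{q^m-1}{q-1}=1+q+\cdots+q^{m-1}$ and $[m]_q!=[1]_q[2]_q\cdots[m]_q$. The $q$-binomial polynomial is ${x\choose k}_q=\frac{x(x-[1]_q)(x-[2]_q)\cdots(x-[k-1]_q)}{[k]_q!}$ for $k\geq1$, with ${x\choose 0}_q=1$. For integers $n,k\geq 0$, let $\mathcal{P}(n,k)$ be the set of lattice paths from $(0,0)$ to $(n+1,k)$ with unit steps $(1,0)$ and $(0,1)$, whose last step is $(1,0)$ and which never rise above the line $y=x$. The Carlitz–Riordan $q$-ballot number is $f(n,k|q)=\sum_{\gamma\in\mathcal{P}(n,k)}q^{A(\gamma)}$, where $A(\gamma)$ is the area of the region under $\gamma$ and above the $x$-axis (so $f(n,k|q)=0$ if $n<k$); $f(n,k|q^{-1})$ denotes this polynomial evaluated at $q^{-1}$. *)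

theory Defs
  imports "HOL-Computational_Algebra.Computational_Algebra"
begin

text \<open>\<open>rat poly fract\<close> is the field of rational functions in one indeterminate over the
  rationals; \<open>qv\<close> is that indeterminate.\<close>

definition qv :: "rat poly fract" where
  "qv = to_fract [:0, 1:]"

definition q_int :: "'a::comm_semiring_1 \<Rightarrow> nat \<Rightarrow> 'a" where
  "q_int q m = (\<Sum>i<m. q ^ i)"

definition q_fact :: "'a::comm_semiring_1 \<Rightarrow> nat \<Rightarrow> 'a" where
  "q_fact q m = (\<Prod>i=1..m. q_int q i)"

definition q_binomial_poly :: "'a::field \<Rightarrow> nat \<Rightarrow> 'a poly" where
  "q_binomial_poly q k = smult (inverse (q_fact q k)) (\<Prod>i<k. [:- q_int q i, 1:])"

datatype step = East | North

text \<open>A path starting at the origin is encoded by its list of steps; after \<open>i\<close> steps it is at the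
  point \<open>(count_list (take i w) East, count_list (take i w) North)\<close>.\<close>

definition ballot_paths :: "nat \<Rightarrow> nat \<Rightarrow> step list set" where
  "ballot_paths n k =
    {w. count_list w East = n + 1 \<and> count_list w North = k \<and> last w = East \<and>
        (\<forall>i\<le>length w. count_list (take i w) North \<le> count_list (take i w) East)}"

text \<open>The region between a path and the horizontal axis is cut by vertical lines into one column
  of width 1 for each east step, whose height is the ordinate of that step.\<close>

definition path_area :: "step list \<Rightarrow> nat" where
  "path_area w = (\<Sum>i | i < length w \<and> w ! i = East. count_list (take i w) North)"

definition q_ballot :: "nat \<Rightarrow> nat \<Rightarrow> 'a::comm_semiring_1 \<Rightarrow> 'a" where
  "q_ballot n k q = (\<Sum>w\<in>ballot_paths n k. q ^ path_area w)"

text \<open>In the next definition only the terms \<open>C n\<close> with \<open>n \<ge> 1\<close> matter. The quotient is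
  taken in the fraction field of the polynomial ring, so that no divisibility is presupposed.\<close>

definition C_sequence :: "(nat \<Rightarrow> rat poly fract poly) \<Rightarrow> bool" where
  "C_sequence C \<longleftrightarrow>
    C 1 = 1 \<and>
    (\<forall>n\<ge>1.
      to_fract (C (n + 1) - C (n + 1) \<circ>\<^sub>p [:- inverse qv, inverse qv:]) / to_fract [:1, qv - 1:]
        = to_fract (C n \<circ>\<^sub>p [:1, qv:]) \<and>
      poly (C (n + 1)) (- 1 / qv) = 0)"

end

theory Submission
  imports Defs
begin

text \<open>Put \<open>L x = q x + 1\<close>, so that \<open>L [m] = [m + 1]\<close>. The \<open>q\<close>-binomial polynomials satisfy
  \<open>B\<^sub>j \<circ> L = q\<^sup>j B\<^sub>j + q\<^sup>j\<^sup>-\<^sup>1 B\<^sub>j\<^sub>-\<^sub>1\<close> and \<open>B\<^sub>j \<circ> L - B\<^sub>j = (1 + (q - 1) x) B\<^sub>j\<^sub>-\<^sub>1\<close>. In coordinates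
  with respect to the \<open>B\<^sub>j\<close>, both the passage from \<open>C\<^sub>n\<close> to \<open>C\<^sub>n \<circ> L\<close> and the difference equation
  become the recurrence
  \<open>f(n, k) = q f(n, k - 1) + q\<^sup>k f(n - 1, k)\<close>, evaluated at \<open>q\<^sup>-\<^sup>1\<close>. The solution is unique because
  the difference of two solutions takes the same value at all of \<open>[-1] = -1/q, [0], [1], \<dots>\<close>,
  and this value is \<open>0\<close>.\<close>

subsection \<open>The recurrence for the ballot numbers\<close>

definition below_diagonal :: "step list \<Rightarrow> bool" where
  "below_diagonal w \<longleftrightarrow>
    (\<forall>i\<le>length w. count_list (take i w) North \<le> count_list (take i w) East)"

text \<open>Ballot paths without their forced final east step. Here the last step is free, so that a
  path can be decomposed by it.\<close>

definition paths_to :: "nat \<Rightarrow> nat \<Rightarrow> step list set" where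
  "paths_to n k = {w. count_list w East = n \<and> count_list w North = k \<and> below_diagonal w}"

lemma below_diagonal_Nil [simp]: "below_diagonal []"
  by (simp add: below_diagonal_def)

lemma below_diagonal_snoc:
  "below_diagonal (w @ [s]) \<longleftrightarrow>
    below_diagonal w \<and> count_list (w @ [s]) North \<le> count_list (w @ [s]) East"
  by (auto simp: below_diagonal_def le_Suc_eq)

lemma below_diagonal_count: "below_diagonal w \<Longrightarrow> count_list w North \<le> count_list w East"
  unfolding below_diagonal_def by (metis order_refl take_all)

lemma path_area_Nil [simp]: "path_area [] = 0"
  by (simp add: path_area_def)

lemma path_area_snoc:
  "path_area (w @ [s]) = path_area w + (if s = East then count_list w North else 0)"
proof -
  have "{i. i < length (w @ [s]) \<and> (w @ [s]) ! i = East} =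
      {i. i < length w \<and> w ! i = East} \<union> (if s = East then {length w} else {})"
    by (auto simp: nth_append less_Suc_eq)
  then have "path_area (w @ [s]) =
      (\<Sum>i\<in>{i. i < length w \<and> w ! i = East} \<union> (if s = East then {length w} else {}).
        count_list (take i (w @ [s])) North)"
    by (simp only: path_area_def)
  also have "\<dots> = path_area w + (if s = East then count_list w North else 0)"
    unfolding path_area_def by (subst sum.union_disjoint) auto
  finally show ?thesis .
qed

lemma length_eq_count_steps: "length w = count_list w East + count_list w North"
proof (induction w)
  case (Cons s w)
  then show ?case by (cases s) auto
qed simp

lemma finite_paths_to: "finite (paths_to n k)"
proof (rule finite_subset)
  show "paths_to n k \<subseteq> {w. set w \<subseteq> {East, North} \<and> length w = n + k}"
    using step.exhaust by (auto simp: paths_to_def length_eq_count_steps)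
  show "finite {w. set w \<subseteq> {East, North} \<and> length w = n + k}"
    by (rule finite_lists_length_eq) simp
qed

text \<open>An appended east step cannot break the diagonal condition: a path below the diagonal
  already has at most as many north as east steps.\<close>

lemma ballot_paths_eq: "ballot_paths n k = (\<lambda>w. w @ [East]) ` paths_to n k"
proof (rule set_eqI)
  fix w
  show "w \<in> ballot_paths n k \<longleftrightarrow> w \<in> (\<lambda>w. w @ [East]) ` paths_to n k"
  proof (cases w rule: rev_cases)
    case Nil
    then show ?thesis by (auto simp: ballot_paths_def)
  next
    case (snoc v s)
    have "w \<in> ballot_paths n k \<longleftrightarrow>
        count_list w East = n + 1 \<and> count_list w North = k \<and> last w = East \<and> below_diagonal w"
      by (simp add: ballot_paths_def below_diagonal_def)
    also have "\<dots> \<longleftrightarrow> s = East \<and> v \<in> paths_to n k"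
      using below_diagonal_count[of v] by (auto simp: snoc below_diagonal_snoc paths_to_def)
    finally show ?thesis using snoc by auto
  qed
qed

definition path_weight :: "nat \<Rightarrow> nat \<Rightarrow> 'a::comm_semiring_1 \<Rightarrow> 'a" where
  "path_weight n k q = (\<Sum>w\<in>paths_to n k. q ^ path_area w)"

text \<open>The final east step runs at height \<open>k\<close> and so adds a column of area
  \<open>k\<close> to every path.\<close>

lemma q_ballot_eq: "q_ballot n k q = q ^ k * path_weight n k q"
proof -
  have "q_ballot n k q = (\<Sum>w\<in>paths_to n k. q ^ path_area (w @ [East]))"
    unfolding q_ballot_def ballot_paths_eq by (subst sum.reindex) (auto simp: inj_on_def)
  also have "\<dots> = (\<Sum>w\<in>paths_to n k. q ^ k * q ^ path_area w)"
    by (rule sum.cong) (auto simp: path_area_snoc paths_to_def power_add mult.commute)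
  finally show ?thesis by (simp add: path_weight_def sum_distrib_left)
qed

lemma paths_to_Suc_0: "paths_to (Suc n) 0 = ballot_paths n 0"
proof (rule set_eqI)
  fix w
  show "w \<in> paths_to (Suc n) 0 \<longleftrightarrow> w \<in> ballot_paths n 0"
  proof (cases w rule: rev_cases)
    case Nil
    then show ?thesis by (auto simp: ballot_paths_eq paths_to_def)
  next
    case (snoc v s)
    then show ?thesis
      by (cases s) (auto simp: ballot_paths_eq paths_to_def below_diagonal_snoc)
  qed
qed

text \<open>Split by the last step. Paths ending in an east step are ballot paths with one column
  less; \<open>k \<le> n\<close> guarantees that an appended north step stays weakly below the
  diagonal.\<close>

lemma paths_to_Suc_Suc:
  assumes "k \<le> n"
  shows "paths_to (Suc n) (Suc k) = ballot_paths n (Suc k) \<union> (\<lambda>w. w @ [North]) ` paths_to (Suc n) k"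
proof (rule set_eqI)
  fix w
  show "w \<in> paths_to (Suc n) (Suc k) \<longleftrightarrow>
      w \<in> ballot_paths n (Suc k) \<union> (\<lambda>w. w @ [North]) ` paths_to (Suc n) k"
  proof (cases w rule: rev_cases)
    case Nil
    then show ?thesis by (auto simp: ballot_paths_eq paths_to_def)
  next
    case (snoc v s)
    then show ?thesis
      using assms below_diagonal_count[of v]
      by (cases s) (auto simp: ballot_paths_eq paths_to_def below_diagonal_snoc)
  qed
qed

lemma q_ballot_0_right: "q_ballot n 0 q = 1"
proof (induction n)
  case 0
  have "paths_to 0 0 = {[]}"
  proof -
    have "w = []" if "w \<in> paths_to 0 0" for w
      using that length_eq_count_steps[of w] by (simp add: paths_to_def)
    moreover have "[] \<in> paths_to 0 0" by (simp add: paths_to_def)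
    ultimately show ?thesis by blast
  qed
  then show ?case by (simp add: q_ballot_eq path_weight_def)
next
  case (Suc n)
  have "q_ballot (Suc n) 0 q = q_ballot n 0 q"
    by (simp only: q_ballot_eq[of "Suc n"] path_weight_def paths_to_Suc_0 q_ballot_def[of n]) simp
  with Suc show ?case by simp
qed

text \<open>A north step adds no area. The common factor \<open>q ^ Suc k\<close> of the stripped
  east step is kept whole by the first class of paths; in the second, all but one \<open>q\<close>
  is absorbed into \<open>q_ballot (Suc n) k q\<close>.\<close>

lemma q_ballot_Suc_Suc:
  assumes "k \<le> n"
  shows "q_ballot (Suc n) (Suc k) q = q ^ Suc k * q_ballot n (Suc k) q + q * q_ballot (Suc n) k q"
proof -
  have "path_weight (Suc n) (Suc k) q =
      (\<Sum>w\<in>ballot_paths n (Suc k). q ^ path_area w) +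
      (\<Sum>w\<in>(\<lambda>w. w @ [North]) ` paths_to (Suc n) k. q ^ path_area w)"
    unfolding path_weight_def paths_to_Suc_Suc[OF assms]
    by (rule sum.union_disjoint) (auto simp: finite_paths_to ballot_paths_eq)
  also have "(\<Sum>w\<in>(\<lambda>w. w @ [North]) ` paths_to (Suc n) k. q ^ path_area w) =
      path_weight (Suc n) k q"
    unfolding path_weight_def
    by (subst sum.reindex) (auto simp: inj_on_def path_area_snoc)
  finally show ?thesis
    by (simp only: q_ballot_eq[of "Suc n"] q_ballot_def[of n]) (simp add: algebra_simps)
qed

text \<open>On the diagonal the east-step class is empty, since the point (n, n + 1) lies above the
  diagonal.\<close>

lemma q_ballot_diagonal: "q_ballot (Suc n) (Suc n) q = q * q_ballot (Suc n) n q"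
proof -
  have "ballot_paths n (Suc n) = {}"
    using below_diagonal_count by (force simp: ballot_paths_eq paths_to_def)
  then have "q_ballot n (Suc n) q = 0" by (simp add: q_ballot_def)
  then show ?thesis by (simp add: q_ballot_Suc_Suc)
qed

subsection \<open>The q-binomial polynomials under the substitution x \<rightarrow> q x + 1\<close>

lemma q_int_0 [simp]: "q_int q 0 = 0"
  by (simp add: q_int_def)

lemma q_int_Suc: "q_int q (Suc m) = q_int q m + q ^ m"
  by (simp add: q_int_def)

lemma q_int_Suc': "q_int q (Suc m) = 1 + q * q_int q m"
proof (induction m)
  case (Suc m)
  have "q_int q (Suc (Suc m)) = 1 + q * q_int q m + q ^ Suc m"
    by (simp only: q_int_Suc[of q "Suc m"] Suc)
  then show ?case by (simp add: q_int_Suc algebra_simps)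
qed (simp add: q_int_Suc)

lemma q_int_times: "(q - 1) * q_int q m = q ^ m - (1::'a::comm_ring_1)"
  by (induction m) (simp_all add: q_int_Suc algebra_simps)

lemma q_fact_Suc: "q_fact q (Suc m) = q_int q (Suc m) * q_fact q m"
  by (simp add: q_fact_def mult.commute)

lemma q_binomial_poly_0 [simp]: "q_binomial_poly q 0 = 1"
  by (simp add: q_binomial_poly_def q_fact_def)

lemma poly_q_binomial_poly_Suc_0 [simp]: "poly (q_binomial_poly q (Suc j)) 0 = 0"
  by (simp add: q_binomial_poly_def poly_prod prod.lessThan_Suc_shift del: prod.lessThan_Suc)

lemma q_binomial_poly_Suc:
  assumes "q_int q (Suc j) \<noteq> 0"
  shows "smult (q_int q (Suc j)) (q_binomial_poly q (Suc j)) =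
    [:- q_int q j, 1:] * q_binomial_poly q j"
proof -
  have "q_int q (Suc j) * inverse (q_fact q (Suc j)) = inverse (q_fact q j)"
    using assms by (simp add: q_fact_Suc)
  then show ?thesis
    by (simp only: q_binomial_poly_def smult_smult prod.lessThan_Suc mult_smult_right mult.commute)
qed

text \<open>L maps each root to the next one: the factor x - [i + 1] becomes q (x - [i]), and only
  the factor x of index 0 turns into the new factor q x + 1.\<close>

lemma prod_pcompose:
  "(\<Prod>i<Suc j. [:- q_int q i, 1:]) \<circ>\<^sub>p [:1, q:] =
    [:1, q:] * smult (q ^ j) (\<Prod>i<j. [:- q_int q i, 1:])" for q :: "'a::comm_ring_1"
proof -
  have "[:- q_int q (Suc i), 1:] \<circ>\<^sub>p [:1, q:] = smult q [:- q_int q i, 1:]" for i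
    by (simp add: pcompose_pCons q_int_Suc')
  then show ?thesis
    by (simp only: prod.lessThan_Suc_shift pcompose_mult pcompose_prod prod_smult)
      (simp add: pcompose_pCons)
qed

lemma q_binomial_poly_pcompose_diff:
  assumes "q_int q (Suc j) \<noteq> 0"
  shows "q_binomial_poly q (Suc j) \<circ>\<^sub>p [:1, q:] - q_binomial_poly q (Suc j) =
    [:1, q - 1:] * q_binomial_poly q j"
proof -
  define P where "P = (\<Prod>i<j. [:- q_int q i, 1:])"
  define c where "c = inverse (q_fact q (Suc j))"
  have c: "c * q_int q (Suc j) = inverse (q_fact q j)"
    using assms by (simp add: c_def q_fact_Suc)
  \<comment> \<open>Both polynomials contain \<open>P\<close>; only these linear cofactors differ.
    Their difference has constant term q^j + [j] = [j + 1] and leading coefficient q^(j+1) - 1 = (q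
    - 1) [j + 1].\<close>
  have "smult (q ^ j) [:1, q:] - [:- q_int q j, 1:] = smult (q_int q (Suc j)) [:1, q - 1:]"
    using q_int_times[of q "Suc j"] by (simp add: q_int_Suc algebra_simps)
  then have *: "[:1, q:] * smult (q ^ j) P - P * [:- q_int q j, 1:] =
      smult (q_int q (Suc j)) ([:1, q - 1:] * P)"
    by (metis left_diff_distrib mult.commute mult_smult_left mult_smult_right)
  have "q_binomial_poly q (Suc j) \<circ>\<^sub>p [:1, q:] - q_binomial_poly q (Suc j) =
      smult c ([:1, q:] * smult (q ^ j) P - P * [:- q_int q j, 1:])"
    unfolding q_binomial_poly_def pcompose_smult prod_pcompose
    by (simp add: P_def c_def smult_diff_right)
  also have "\<dots> = [:1, q - 1:] * q_binomial_poly q j"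
    unfolding * smult_smult c by (simp add: q_binomial_poly_def P_def)
  finally show ?thesis .
qed

lemma q_binomial_poly_pcompose:
  assumes "q_int q (Suc j) \<noteq> 0"
  shows "q_binomial_poly q (Suc j) \<circ>\<^sub>p [:1, q:] =
    smult (q ^ Suc j) (q_binomial_poly q (Suc j)) + smult (q ^ j) (q_binomial_poly q j)"
proof -
  \<comment> \<open>Expanding 1 + (q - 1) x around the root [j] makes the product with B_j a
    combination of B_(j+1) and B_j.\<close>
  have "[:1, q - 1:] = smult (q - 1) [:- q_int q j, 1:] + [:q ^ j:]"
    using q_int_times[of q j] by simp
  then have "[:1, q - 1:] * q_binomial_poly q j =
      smult (q - 1) ([:- q_int q j, 1:] * q_binomial_poly q j) + smult (q ^ j) (q_binomial_poly q j)"
    by (simp only: distrib_right mult_smult_left) simp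
  also have "[:- q_int q j, 1:] * q_binomial_poly q j =
      smult (q_int q (Suc j)) (q_binomial_poly q (Suc j))"
    using q_binomial_poly_Suc[OF assms] by simp
  also have "smult (q - 1) \<dots> = smult (q ^ Suc j - 1) (q_binomial_poly q (Suc j))"
    by (simp only: smult_smult q_int_times)
  finally show ?thesis
    using q_binomial_poly_pcompose_diff[OF assms]
    by (simp add: smult_diff_left algebra_simps)
qed

lemma sum_q_binomial_poly_pcompose_diff:
  assumes "\<And>j. q_int q (Suc j) \<noteq> 0"
  shows "(\<Sum>j\<le>Suc n. smult (c j) (q_binomial_poly q j)) \<circ>\<^sub>p [:1, q:] -
      (\<Sum>j\<le>Suc n. smult (c j) (q_binomial_poly q j)) =
    [:1, q - 1:] * (\<Sum>j\<le>n. smult (c (Suc j)) (q_binomial_poly q j))"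
proof -
  have "(\<Sum>j\<le>Suc n. smult (c j) (q_binomial_poly q j)) \<circ>\<^sub>p [:1, q:] -
      (\<Sum>j\<le>Suc n. smult (c j) (q_binomial_poly q j)) =
      (\<Sum>j\<le>Suc n. smult (c j) (q_binomial_poly q j \<circ>\<^sub>p [:1, q:] - q_binomial_poly q j))"
    by (simp only: pcompose_sum pcompose_smult sum_subtractf smult_diff_right)
  also have "\<dots> = (\<Sum>j\<le>n. smult (c (Suc j)) ([:1, q - 1:] * q_binomial_poly q j))"
    by (subst sum.atMost_Suc_shift)
      (simp only: q_binomial_poly_0 pcompose_1 diff_self smult_0_right add_0
        q_binomial_poly_pcompose_diff[OF assms])
  finally show ?thesis by (simp only: sum_distrib_left mult_smult_right)
qed

lemma sum_q_binomial_poly_pcompose: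
  assumes "\<And>j. q_int q (Suc j) \<noteq> 0" and "c (Suc n) = 0"
  shows "(\<Sum>j\<le>n. smult (c j) (q_binomial_poly q j)) \<circ>\<^sub>p [:1, q:] =
    (\<Sum>j\<le>n. smult (q ^ j * (c j + c (Suc j))) (q_binomial_poly q j))"
proof -
  have "(\<Sum>j\<le>n. smult (c j) (q_binomial_poly q j)) \<circ>\<^sub>p [:1, q:] =
      (\<Sum>j\<le>n. smult (q ^ j * c j) (q_binomial_poly q j)) +
      (\<Sum>j<n. smult (q ^ j * c (Suc j)) (q_binomial_poly q j))"
  proof (induction n)
    case (Suc n)
    then show ?case
      by (simp add: pcompose_add pcompose_smult q_binomial_poly_pcompose[OF assms(1)]
          smult_add_right ac_simps flip: lessThan_Suc_atMost)
  qed simp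
  \<comment> \<open>The added term \<open>j = n\<close> vanishes because
    \<open>c (Suc n) = 0\<close>.\<close>
  moreover have "(\<Sum>j<n. smult (q ^ j * c (Suc j)) (q_binomial_poly q j)) =
      (\<Sum>j\<le>n. smult (q ^ j * c (Suc j)) (q_binomial_poly q j))"
    using assms(2) by (simp flip: lessThan_Suc_atMost)
  ultimately show ?thesis
    by (simp add: sum.distrib distrib_left smult_add_left)
qed

lemma poly_sum_q_binomial_poly_0:
  "poly (\<Sum>j\<le>n. smult (c j) (q_binomial_poly q j)) 0 = c 0"
  by (induction n) (simp_all add: poly_sum)

subsection \<open>The coefficients\<close>

text \<open>With \<open>n = j + k\<close> resp. \<open>n = j + k + 1\<close>, these are the coefficients of \<open>B\<^sub>j\<close> in
  \<open>C\<^sub>n\<^sub>+\<^sub>1(x)\<close> resp. \<open>C\<^sub>n(q x + 1)\<close>, the exponents being rewritten without subtraction.\<close>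

definition coeff_C :: "'a::field \<Rightarrow> nat \<Rightarrow> nat \<Rightarrow> 'a" where
  "coeff_C q j k =
    q_ballot (2 * j + k) k (inverse q) * q ^ (j * j + 2 * j * k + k * (k + 1) div 2)"

definition coeff_E :: "'a::field \<Rightarrow> nat \<Rightarrow> nat \<Rightarrow> 'a" where
  "coeff_E q j k =
    q_ballot (2 * j + k + 1) k (inverse q) * q ^ (j * j + j + 2 * j * k + k + k * (k + 1) div 2)"

section \<open>Recurrences linking the two coefficient families\<close>

lemma triangle_Suc: "Suc k * (Suc k + 1) div 2 = k * (k + 1) div 2 + Suc k"
proof -
  have "Suc k * (Suc k + 1) = k * (k + 1) + 2 * Suc k" by simp
  then show ?thesis by simp
qed

lemma coeff_E_0: "coeff_E q j 0 = q ^ j * coeff_C q j 0"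
  by (simp add: coeff_E_def coeff_C_def q_ballot_0_right power_add)

lemma coeff_C_0: "coeff_C q (Suc j) 0 = q ^ Suc j * coeff_E q j 0"
  by (simp add: coeff_E_def coeff_C_def q_ballot_0_right power_add)

lemma coeff_E_Suc:
  assumes "q \<noteq> 0"
  shows "coeff_E q j (Suc k) = q ^ j * (coeff_C q j (Suc k) + coeff_C q (Suc j) k)"
proof -
  \<comment> \<open>\<open>e\<close> balances the three exponents: from
    \<open>q ^ (e + k + 2)\<close> on the left, the factors \<open>inverse q ^ Suc k\<close> and
    \<open>inverse q\<close> of the ballot recurrence leave \<open>e + 1\<close> and
    \<open>e + k + 1\<close>.\<close>
  define e where "e = j * j + j + 2 * j * k + 2 * j + k * (k + 1) div 2 + k"
  have 1: "j * j + j + 2 * j * Suc k + Suc k + Suc k * (Suc k + 1) div 2 = e + k + 2"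
    unfolding triangle_Suc e_def by simp
  have 2: "j + (j * j + 2 * j * Suc k + Suc k * (Suc k + 1) div 2) = e + 1"
    unfolding triangle_Suc e_def by simp
  have 3: "j + (Suc j * Suc j + 2 * Suc j * k + k * (k + 1) div 2) = e + k + 1"
    unfolding e_def by simp
  have "coeff_E q j (Suc k) = q ^ (e + k + 2) * q_ballot (2 * j + k + 2) (Suc k) (inverse q)"
    unfolding coeff_E_def 1 by simp
  also have "\<dots> = q ^ (e + k + 2) * (inverse q ^ Suc k * q_ballot (2 * j + k + 1) (Suc k) (inverse q)
      + inverse q * q_ballot (2 * j + k + 2) k (inverse q))"
    using q_ballot_Suc_Suc[of k "2 * j + k + 1" "inverse q"] by simp
  also have "\<dots> = q ^ (e + 1) * q_ballot (2 * j + k + 1) (Suc k) (inverse q)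
      + q ^ (e + k + 1) * q_ballot (2 * j + k + 2) k (inverse q)"
    using assms by (simp add: field_simps power_add)
  also have "\<dots> = q ^ j * (coeff_C q j (Suc k) + coeff_C q (Suc j) k)"
    unfolding coeff_C_def 2[symmetric] 3[symmetric] power_add
    by (simp add: algebra_simps eval_nat_numeral)
  finally show ?thesis .
qed

lemma coeff_C_Suc:
  assumes "q \<noteq> 0"
  shows "coeff_C q (Suc j) (Suc k) = q ^ Suc j * (coeff_E q j (Suc k) + coeff_E q (Suc j) k)"
proof -
  \<comment> \<open>The same balancing, now with the ballot recurrence taken from
    \<open>2 * j + k + 2\<close> to \<open>2 * j + k + 3\<close>.\<close>
  define e where "e = j * j + 4 * j + 2 * j * k + 2 * k + k * (k + 1) div 2 + 2"
  have 1: "Suc j * Suc j + 2 * Suc j * Suc k + Suc k * (Suc k + 1) div 2 = e + k + 2"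
    unfolding triangle_Suc e_def by simp
  have 2: "Suc j + (j * j + j + 2 * j * Suc k + Suc k + Suc k * (Suc k + 1) div 2) = e + 1"
    unfolding triangle_Suc e_def by simp
  have 3: "Suc j + (Suc j * Suc j + Suc j + 2 * Suc j * k + k + k * (k + 1) div 2) = e + k + 1"
    unfolding e_def by simp
  have "coeff_C q (Suc j) (Suc k) = q ^ (e + k + 2) * q_ballot (2 * j + k + 3) (Suc k) (inverse q)"
    unfolding coeff_C_def 1 by (simp add: eval_nat_numeral)
  also have "\<dots> = q ^ (e + k + 2) * (inverse q ^ Suc k * q_ballot (2 * j + k + 2) (Suc k) (inverse q)
      + inverse q * q_ballot (2 * j + k + 3) k (inverse q))"
    using q_ballot_Suc_Suc[of k "2 * j + k + 2" "inverse q"] by (simp add: eval_nat_numeral)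
  also have "\<dots> = q ^ (e + 1) * q_ballot (2 * j + k + 2) (Suc k) (inverse q)
      + q ^ (e + k + 1) * q_ballot (2 * j + k + 3) k (inverse q)"
    using assms by (simp add: field_simps power_add)
  also have "\<dots> = q ^ Suc j * (coeff_E q j (Suc k) + coeff_E q (Suc j) k)"
    unfolding coeff_E_def 2[symmetric] 3[symmetric] power_add
    by (simp add: algebra_simps eval_nat_numeral)
  finally show ?thesis .
qed

text \<open>The diagonal case of the ballot recurrence; it will give the vanishing at -1/q.\<close>

lemma coeff_C_0_Suc:
  assumes "q \<noteq> 0"
  shows "coeff_C q 0 (Suc k) = coeff_E q 0 k"
proof -
  have "Suc k * (Suc k + 1) div 2 = Suc (k + k * (k + 1) div 2)"
    unfolding triangle_Suc by simp
  then have "q ^ (Suc k * (Suc k + 1) div 2) = q * q ^ (k + k * (k + 1) div 2)"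
    by (simp only: power_Suc)
  then show ?thesis
    using assms by (simp add: coeff_C_def coeff_E_def q_ballot_diagonal)
qed

section \<open>Agreement with the exponents in the theorem\<close>

lemma exponent_C:
  assumes "j \<le> n"
  shows "q_ballot (n + j) (n - j) (inverse q) * q ^ (j * n + (n - j) * (n + j + 1) div 2) =
    coeff_C q j (n - j)"
proof -
  define k where "k = n - j"
  have n: "n = j + k" using assms by (simp add: k_def)
  have "k * (n + j + 1) = k * (k + 1) + 2 * (j * k)" by (simp add: n algebra_simps)
  then have "k * (n + j + 1) div 2 = k * (k + 1) div 2 + j * k" by simp
  then have "j * n + k * (n + j + 1) div 2 = j * j + 2 * j * k + k * (k + 1) div 2"
    by (simp add: n algebra_simps)
  moreover have "n + j = 2 * j + k" by (simp add: n)
  ultimately show ?thesis unfolding coeff_C_def k_def[symmetric] by (simp only:)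
qed

lemma exponent_E:
  assumes "j \<le> n"
  shows "q_ballot (Suc n + j) (n - j) (inverse q) *
      q ^ (j * Suc n + Suc n * (Suc n + 1) div 2 - (j + 1) * (j + 2) div 2) =
    coeff_E q j (n - j)"
proof -
  define k where "k = n - j"
  have n: "n = j + k" using assms by (simp add: k_def)
  have "Suc n * (Suc n + 1) = (j + 1) * (j + 2) + k * (k + 1) + 2 * (j * k + k)"
    by (simp add: n algebra_simps)
  \<comment> \<open>Halving distributes over the sum thanks to parity. The subtracted triangular
    number thereby appears as a summand, so the natural-number subtraction is exact.\<close>
  moreover have "(a + b + 2 * c) div 2 = a div 2 + b div 2 + c" if "even a" for a b c :: nat
    using that by presburger
  moreover have "even ((j + 1) * (j + 2))" by simp
  ultimately have
    "Suc n * (Suc n + 1) div 2 = (j + 1) * (j + 2) div 2 + k * (k + 1) div 2 + (j * k + k)"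
    by (simp only:)
  then have "j * Suc n + Suc n * (Suc n + 1) div 2 - (j + 1) * (j + 2) div 2 =
      j * j + j + 2 * j * k + k + k * (k + 1) div 2"
    by (simp add: n algebra_simps)
  moreover have "Suc n + j = 2 * j + k + 1" by (simp add: n)
  ultimately show ?thesis
    unfolding coeff_E_def k_def[symmetric] by (simp only:)
qed

subsection \<open>Existence and uniqueness\<close>

text \<open>The candidate for C_(n+1)(x), with the index shifted by one; \<open>poly_E q n\<close>
  is the candidate for C_(n+1)(q x + 1).\<close>

definition poly_C :: "'a::field \<Rightarrow> nat \<Rightarrow> 'a poly" where
  "poly_C q n = (\<Sum>j\<le>n. smult (coeff_C q j (n - j)) (q_binomial_poly q j))"

definition poly_E :: "'a::field \<Rightarrow> nat \<Rightarrow> 'a poly" where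
  "poly_E q n = (\<Sum>j\<le>n. smult (coeff_E q j (n - j)) (q_binomial_poly q j))"

lemma poly_C_pcompose:
  assumes "q \<noteq> 0" and "\<And>j. q_int q (Suc j) \<noteq> 0"
  shows "poly_C q n \<circ>\<^sub>p [:1, q:] = poly_E q n"
proof -
  \<comment> \<open>The cutoff matters: at \<open>j = Suc n\<close> the truncated
    \<open>n - j\<close> would give \<open>coeff_C q (Suc n) 0\<close>, a nonzero power of
    \<open>q\<close>.\<close>
  define c where "c j = (if j \<le> n then coeff_C q j (n - j) else 0)" for j
  have "q ^ j * (c j + c (Suc j)) = coeff_E q j (n - j)" if "j \<le> n" for j
  proof (cases "j = n")
    case False
    then have "n - j = Suc (n - Suc j)" using that by simp
    then show ?thesis using that False assms by (simp add: c_def coeff_E_Suc)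
  qed (simp add: c_def coeff_E_0)
  moreover have "poly_C q n = (\<Sum>j\<le>n. smult (c j) (q_binomial_poly q j))"
    by (simp add: poly_C_def c_def)
  moreover have "c (Suc n) = 0" by (simp add: c_def)
  ultimately show ?thesis
    using sum_q_binomial_poly_pcompose[of q c n] assms(2) by (simp add: poly_E_def)
qed

text \<open>These are the coefficients of C_(n+2) with index shifted by one, as the difference
  C_(n+2)(L x) - C_(n+2)(x) produces them. The scalar \<open>q\<close> raises \<open>q ^ j\<close>
  to the \<open>q ^ Suc j\<close> of \<open>coeff_C_Suc\<close>.\<close>

lemma poly_E_pcompose:
  assumes "q \<noteq> 0" and "\<And>j. q_int q (Suc j) \<noteq> 0"
  shows "smult q (poly_E q n \<circ>\<^sub>p [:1, q:]) =
    (\<Sum>j\<le>n. smult (coeff_C q (Suc j) (n - j)) (q_binomial_poly q j))"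
proof -
  define c where "c j = (if j \<le> n then coeff_E q j (n - j) else 0)" for j
  have *: "q * (q ^ j * (c j + c (Suc j))) = coeff_C q (Suc j) (n - j)" if "j \<le> n" for j
  proof (cases "j = n")
    case False
    then have "n - j = Suc (n - Suc j)" using that by simp
    then show ?thesis using that False assms by (simp add: c_def coeff_C_Suc)
  qed (simp add: c_def coeff_C_0)
  have "poly_E q n = (\<Sum>j\<le>n. smult (c j) (q_binomial_poly q j))"
    by (simp add: poly_E_def c_def)
  moreover have "c (Suc n) = 0" by (simp add: c_def)
  moreover have "smult q (\<Sum>j\<le>n. p j) = (\<Sum>j\<le>n. smult q (p j))" for p
    by (induction n) (simp_all add: smult_add_right)
  ultimately have "smult q (poly_E q n \<circ>\<^sub>p [:1, q:]) =
      (\<Sum>j\<le>n. smult (q * (q ^ j * (c j + c (Suc j)))) (q_binomial_poly q j))"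
    using sum_q_binomial_poly_pcompose[of q c n] assms(2) by simp
  also have "\<dots> = (\<Sum>j\<le>n. smult (coeff_C q (Suc j) (n - j)) (q_binomial_poly q j))"
    using * by simp
  finally show ?thesis .
qed

lemma poly_C_difference_equation:
  assumes "q \<noteq> 0" and "\<And>j. q_int q (Suc j) \<noteq> 0"
  shows "poly_C q (Suc n) - poly_C q (Suc n) \<circ>\<^sub>p [:- inverse q, inverse q:] =
    [:1, q - 1:] * poly_E q n"
proof -
  define M where "M = [:- inverse q, inverse q:]"
  have LM: "[:1, q:] \<circ>\<^sub>p M = [:0, 1:]"
    using assms(1) by (simp add: M_def pcompose_pCons)
  have inv: "(P \<circ>\<^sub>p [:1, q:]) \<circ>\<^sub>p M = P" for P
    by (simp add: pcompose_assoc[symmetric] LM)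
  \<comment> \<open>The equation is first proved after substituting L, where both sides are explicit
    in the B_j, and then pulled back along the inverse \<open>M\<close> of L.\<close>
  have "poly_C q (Suc n) \<circ>\<^sub>p [:1, q:] - poly_C q (Suc n) =
      [:1, q - 1:] * smult q (poly_E q n \<circ>\<^sub>p [:1, q:])"
    unfolding poly_E_pcompose[OF assms]
    using sum_q_binomial_poly_pcompose_diff[OF assms(2), of "\<lambda>j. coeff_C q j (Suc n - j)" n]
    by (simp only: poly_C_def diff_Suc_Suc)
  then have "(poly_C q (Suc n) \<circ>\<^sub>p [:1, q:] - poly_C q (Suc n)) \<circ>\<^sub>p M =
      ([:1, q - 1:] * smult q (poly_E q n \<circ>\<^sub>p [:1, q:])) \<circ>\<^sub>p M"
    by simp
  then have "poly_C q (Suc n) - poly_C q (Suc n) \<circ>\<^sub>p M =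
      smult q ([:1, q - 1:] \<circ>\<^sub>p M) * poly_E q n"
    by (simp only: pcompose_diff pcompose_mult pcompose_smult inv mult_smult_left mult_smult_right)
  \<comment> \<open>1 + (q - 1) x is an eigenvector of substituting \<open>M\<close>, with
    eigenvalue 1/q, which cancels the scalar \<open>q\<close>.\<close>
  also have "smult q ([:1, q - 1:] \<circ>\<^sub>p M) = [:1, q - 1:]"
    using assms(1) by (simp add: M_def pcompose_pCons field_simps)
  finally show ?thesis by (simp add: M_def)
qed

lemma poly_poly_C_Suc:
  assumes "q \<noteq> 0" and "\<And>j. q_int q (Suc j) \<noteq> 0"
  shows "poly (poly_C q (Suc n)) (- 1 / q) = 0"
proof -
  \<comment> \<open>The difference equation at x = 0, which x -> (x - 1)/q sends to -1/q. Values at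
    0 are the coefficients of B_0, and these agree by \<open>coeff_C_0_Suc\<close>.\<close>
  have "poly (poly_C q (Suc n)) 0 - poly (poly_C q (Suc n)) (- inverse q) = poly (poly_E q n) 0"
    using arg_cong[OF poly_C_difference_equation[OF assms, of n], of "\<lambda>p. poly p 0"]
    by (simp add: poly_pcompose)
  moreover have "poly (poly_C q (Suc n)) 0 = coeff_C q 0 (Suc n)"
    unfolding poly_C_def by (simp only: poly_sum_q_binomial_poly_0 diff_zero)
  moreover have "poly (poly_E q n) 0 = coeff_E q 0 n"
    unfolding poly_E_def by (simp only: poly_sum_q_binomial_poly_0 diff_zero)
  ultimately show ?thesis
    using coeff_C_0_Suc[OF assms(1)] by (simp add: divide_inverse)
qed

lemma eq_0_if_invariant:
  fixes P :: "'a::field poly"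
  assumes "q \<noteq> 0" and "inj (q_int q)"
    and P: "P = P \<circ>\<^sub>p [:- inverse q, inverse q:]" "poly P (- 1 / q) = 0"
  shows "P = 0"
proof (rule ccontr)
  assume "P \<noteq> 0"
  have step: "poly P x = poly P ((x - 1) / q)" for x
    by (subst P(1)) (simp add: poly_pcompose divide_inverse algebra_simps)
  \<comment> \<open>x -> (x - 1)/q sends [m + 1] to [m] and [0] to -1/q, so the zero at -1/q
    propagates to infinitely many points.\<close>
  have "poly P (q_int q m) = 0" for m
  proof (induction m)
    case 0
    show ?case using step[of 0] P(2) by simp
  next
    case (Suc m)
    then show ?case using step[of "q_int q (Suc m)"] assms(1) by (simp add: q_int_Suc')
  qed
  then have "range (q_int q) \<subseteq> {x. poly P x = 0}" by auto
  then have "finite (range (q_int q))"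
    using poly_roots_finite[OF \<open>P \<noteq> 0\<close>] finite_subset by blast
  then show False using assms(2) finite_imageD infinite_UNIV_nat by blast
qed

section \<open>Specialization to the indeterminate\<close>

lemma qv_nonzero: "qv \<noteq> 0"
  by (simp add: qv_def)

text \<open>[m] determines q^m through (q - 1) [m] = q^m - 1, and powers of the indeterminate are
  told apart by degree.\<close>

lemma inj_q_int_qv: "inj (q_int qv)"
proof (rule injI)
  fix m n
  assume "q_int qv m = q_int qv n"
  then have "qv ^ m = qv ^ n" using q_int_times[of qv m] q_int_times[of qv n] by simp
  moreover have "qv ^ i = to_fract ([:0, 1:] ^ i)" for i
    by (induction i) (simp_all add: qv_def del: mult_pCons_left)
  ultimately have "[:0, 1:] ^ m = ([:0, 1:] ^ n :: rat poly)" by simp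
  then have "degree ([:0, 1:] ^ m :: rat poly) = degree ([:0, 1:] ^ n :: rat poly)" by simp
  then show "m = n" by (simp add: degree_power_eq)
qed

lemma q_int_qv_nonzero: "q_int qv (Suc j) \<noteq> 0"
  using inj_q_int_qv by (metis injD nat.distinct(2) q_int_0)

lemma C_sequence_iff:
  "C_sequence C \<longleftrightarrow> C 1 = 1 \<and> (\<forall>n\<ge>1.
    C (n + 1) - C (n + 1) \<circ>\<^sub>p [:- inverse qv, inverse qv:] = [:1, qv - 1:] * (C n \<circ>\<^sub>p [:1, qv:]) \<and>
    poly (C (n + 1)) (- 1 / qv) = 0)"
proof -
  \<comment> \<open>The denominator is nonzero, having constant term 1, and \<open>to_fract\<close>
    is injective, so the quotient equation is a polynomial identity.\<close>
  have "to_fract A / to_fract [:1, qv - 1:] = to_fract B \<longleftrightarrow> A = [:1, qv - 1:] * B" for A B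
    by (simp add: divide_eq_eq mult.commute flip: to_fract_mult del: mult_pCons_left mult_pCons_right)
  then show ?thesis unfolding C_sequence_def by (simp only:)
qed

lemma poly_C_0: "poly_C q 0 = 1"
  by (simp add: poly_C_def coeff_C_def q_ballot_0_right)

lemma C_sequence_poly_C: "C_sequence (\<lambda>n. poly_C qv (n - 1))"
  unfolding C_sequence_iff
proof (intro conjI allI impI)
  fix n :: nat
  assume "1 \<le> n"
  then obtain m where n: "n = Suc m" by (cases n) auto
  show "poly_C qv (n + 1 - 1) - poly_C qv (n + 1 - 1) \<circ>\<^sub>p [:- inverse qv, inverse qv:] =
      [:1, qv - 1:] * (poly_C qv (n - 1) \<circ>\<^sub>p [:1, qv:])"
    by (simp only: n diff_Suc_1 add_diff_cancel_right'
        poly_C_difference_equation[OF qv_nonzero q_int_qv_nonzero]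
        poly_C_pcompose[OF qv_nonzero q_int_qv_nonzero])
  show "poly (poly_C qv (n + 1 - 1)) (- 1 / qv) = 0"
    using poly_poly_C_Suc[OF qv_nonzero q_int_qv_nonzero] by (simp only: n add_diff_cancel_right')
qed (simp add: poly_C_0)

lemma C_sequence_unique:
  assumes C: "C_sequence C" and D: "C_sequence D" and "n \<ge> 1"
  shows "C n = D n"
  using \<open>n \<ge> 1\<close>
proof (induction n rule: dec_induct)
  case base
  show ?case using C D by (simp add: C_sequence_iff)
next
  case (step n)
  let ?P = "C (Suc n) - D (Suc n)"
  have "?P - ?P \<circ>\<^sub>p [:- inverse qv, inverse qv:] =
      (C (n + 1) - C (n + 1) \<circ>\<^sub>p [:- inverse qv, inverse qv:]) -
      (D (n + 1) - D (n + 1) \<circ>\<^sub>p [:- inverse qv, inverse qv:])"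
    by (simp add: pcompose_diff)
  also have "\<dots> = [:1, qv - 1:] * (C n \<circ>\<^sub>p [:1, qv:]) - [:1, qv - 1:] * (D n \<circ>\<^sub>p [:1, qv:])"
    using C D step by (simp only: C_sequence_iff)
  \<comment> \<open>The induction hypothesis identifies the right-hand sides, leaving a difference
    invariant under x -> (x - 1)/q.\<close>
  also have "\<dots> = 0" using step by simp
  finally have "?P = ?P \<circ>\<^sub>p [:- inverse qv, inverse qv:]" by simp
  moreover have "poly ?P (- 1 / qv) = 0"
    using C D step by (simp add: C_sequence_iff)
  ultimately have "?P = 0" using eq_0_if_invariant qv_nonzero inj_q_int_qv by blast
  then show ?case by simp
qed

theorem theorem1:
  shows "(\<exists>C. C_sequence C) \<and>
    (\<forall>C. C_sequence C \<longrightarrow>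
      (\<forall>n. C (n + 1) =
        (\<Sum>j=0..n.
          smult (q_ballot (n + j) (n - j) (inverse qv) * qv ^ (j * n + (n - j) * (n + j + 1) div 2))
            (q_binomial_poly qv j))) \<and>
      (\<forall>n\<ge>1. C n \<circ>\<^sub>p [:1, qv:] =
        (\<Sum>j=0..n - 1.
          smult (q_ballot (n + j) (n - 1 - j) (inverse qv) *
              qv ^ (j * n + n * (n + 1) div 2 - (j + 1) * (j + 2) div 2))
            (q_binomial_poly qv j))))"
proof (intro conjI allI impI)
  show "\<exists>C. C_sequence C" using C_sequence_poly_C by blast
next
  fix C :: "nat \<Rightarrow> rat poly fract poly" and n :: nat
  assume "C_sequence C"
  then have "C (n + 1) = poly_C qv n"
    using C_sequence_unique[OF _ C_sequence_poly_C, of C "n + 1"] by simp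
  also have "\<dots> = (\<Sum>j=0..n.
      smult (q_ballot (n + j) (n - j) (inverse qv) * qv ^ (j * n + (n - j) * (n + j + 1) div 2))
        (q_binomial_poly qv j))"
    unfolding poly_C_def atLeast0AtMost by (intro sum.cong refl) (simp only: exponent_C atMost_iff)
  finally show "C (n + 1) = \<dots>" .
next
  fix C :: "nat \<Rightarrow> rat poly fract poly" and n :: nat
  assume C: "C_sequence C" and "1 \<le> n"
  then obtain m where n: "n = Suc m" by (cases n) auto
  have "C n = poly_C qv m"
    using C_sequence_unique[OF C C_sequence_poly_C, of n] n by simp
  then have "C n \<circ>\<^sub>p [:1, qv:] = poly_E qv m"
    using poly_C_pcompose[OF qv_nonzero q_int_qv_nonzero] by simp
  also have "\<dots> = (\<Sum>j=0..n - 1.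
      smult (q_ballot (n + j) (n - 1 - j) (inverse qv) *
          qv ^ (j * n + n * (n + 1) div 2 - (j + 1) * (j + 2) div 2))
        (q_binomial_poly qv j))"
    unfolding poly_E_def atLeast0AtMost n diff_Suc_1
    by (intro sum.cong refl) (simp only: exponent_E atMost_iff)
  finally show "C n \<circ>\<^sub>p [:1, qv:] = \<dots>" .
qed

end
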